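(* Let $s,r,m,n \in \mathbb{N}$ with $s \leq r \leq \min\{m,n\}$ and let $K$ be a field with $|K| \geq r+1$. Then: - if $s = r$, $$a^K_{ech}(m \times n; s,r) = rn - \frac{r(r+1)}{2};$$ - if $s < r$, $$sn - \frac{s(s+1)}{2} + n - s \;\leq\; a^K_{ech}(m \times n; s,r) \;\leq\; rn - \frac{r(r+1)}{2} + 1.$$
   Context: $\mathbb{N}$ includes $0$. $K^{m \times n}$ denotes the vector space of $(m \times n)$-matrices over $K$, and $rk$ denotes the rank. A matrix is in row echelon form if all its zero rows are below all its nonzero rows and the first nonzero entry (pivot) of each nonzero row after the first lies in a column strictly to the right of the column of the pivot of the preceding row (pivots are arbitrary nonzero elements of $K$, not required to be $1$, and entries above pivots are arbitrary). Let $\mathcal{A}_{ech}^K(m \times n; s,r)$ be the set of all (nonempty) affine subspaces $S$ of $K^{m \times n}$ such that every $A \in S$ is in row echelon form, $s = \min\{rk(A) \mid A \in S\}$ and $r = \max\{rk(A) \mid A \in S\}$. Define $a_{ech}^K(m \times n; s,r) = \max\{\dim S \mid S \in \mathcal{A}_{ech}^K(m \times n; s,r)\}$. *)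

theory Defs
  imports "Jordan_Normal_Form.DL_Rank"
begin

definition zero_row :: "'a::zero mat \<Rightarrow> nat \<Rightarrow> bool" where
  "zero_row A i \<longleftrightarrow> (\<forall>j < dim_col A. A $$ (i, j) = 0)"

definition pivot_col :: "'a::zero mat \<Rightarrow> nat \<Rightarrow> nat" where
  "pivot_col A i = (LEAST j. j < dim_col A \<and> A $$ (i, j) \<noteq> 0)"

(* Unlike row_echelon_form from Gauss_Jordan_Elimination (the reduced form), pivots are
   arbitrary nonzero elements and the entries above a pivot are arbitrary. *)
definition row_echelon :: "'a::zero mat \<Rightarrow> bool" where
  "row_echelon A \<longleftrightarrow>
     (\<forall>i k. i < k \<longrightarrow> k < dim_row A \<longrightarrow> zero_row A i \<longrightarrow> zero_row A k) \<and>
     (\<forall>i. Suc i < dim_row A \<longrightarrow> \<not> zero_row A i \<longrightarrow> \<not> zero_row A (Suc i) \<longrightarrow>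
          pivot_col A i < pivot_col A (Suc i))"

definition mat_affine_subspace :: "nat \<Rightarrow> nat \<Rightarrow> 'a::field mat set \<Rightarrow> bool" where
  "mat_affine_subspace m n S \<longleftrightarrow>
     (\<exists>A0 \<in> carrier_mat m n. \<exists>W.
        VectorSpace.subspace class_ring W (module_mat TYPE('a) m n) \<and> S = {A0 + B | B. B \<in> W})"

definition mat_direction :: "'a::field mat set \<Rightarrow> 'a mat set" where
  "mat_direction S = {A - B | A B. A \<in> S \<and> B \<in> S}"

definition mat_affine_dim :: "nat \<Rightarrow> nat \<Rightarrow> 'a::field mat set \<Rightarrow> nat" where
  "mat_affine_dim m n S =
     vectorspace.dim class_ring ((module_mat TYPE('a) m n)\<lparr>carrier := mat_direction S\<rparr>)"

(* The dimension argument of vec_space.rank is the number of rows. *)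
definition ech_affine_spaces :: "nat \<Rightarrow> nat \<Rightarrow> nat \<Rightarrow> nat \<Rightarrow> 'a::field mat set set" where
  "ech_affine_spaces m n s r =
     {S. mat_affine_subspace m n S \<and> (\<forall>A \<in> S. row_echelon A) \<and>
         s = Min {vec_space.rank m A | A. A \<in> S} \<and>
         r = Max {vec_space.rank m A | A. A \<in> S}}"

(* The type argument carries the field K, which the remaining arguments do not determine. *)
definition a_ech :: "'a::field itself \<Rightarrow> nat \<Rightarrow> nat \<Rightarrow> nat \<Rightarrow> nat \<Rightarrow> nat" where
  "a_ech K m n s r =
     Max {mat_affine_dim m n S | S :: 'a mat set. S \<in> ech_affine_spaces m n s r}"

lemma vectorspace_module_mat:
  "vectorspace class_ring (module_mat TYPE('a::field) m n)"
proof -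
  interpret field "class_ring :: 'a ring" by (rule class_field)
  interpret abelian_group "module_mat TYPE('a) m n" by (rule abelian_group_mat)
  have "Module.module class_ring (module_mat TYPE('a) m n)"
    by unfold_locales
      (auto simp: module_mat_simps class_ring_simps add_smult_distrib_left_mat
        add_smult_distrib_right_mat intro!: eq_matI)
  then show ?thesis
    by (simp add: vectorspace_def class_field)
qed

end

theory Submission
  imports Defs "HOL-Library.Product_Lexorder"
begin

text \<open>
  Read the entries of a matrix row by row. Gaussian elimination shows that the dimension of a
  linear space \<open>W\<close> of matrices is the number of positions at which some member of \<open>W\<close> has its first
  nonzero entry (\<open>dim_mat_subspace\<close>). Both bounds are obtained by counting these leading positions
  for the direction space \<open>W\<close> of an affine space \<open>S\<close> of row echelon matrices.

  Upper bound. A row echelon matrix of rank at most \<open>r\<close> vanishes to the left of the diagonal and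
  from row \<open>r\<close> on (rows and columns are counted from \<open>0\<close>), so all leading positions lie in the
  staircase \<open>i < r\<close>, \<open>i \<le> j < n\<close>, whose row \<open>i\<close> has \<open>n - i\<close> elements. Call row \<open>i\<close> full if each of
  its \<open>n - i\<close> positions is leading; every row that is not full reduces the count by at least one. If row \<open>i\<close>
  is full, then it can be cleared by adding elements of \<open>W\<close> that are zero above it, so some member
  of \<open>S\<close> has row \<open>i\<close> equal to zero, and hence has rank at most \<open>i < r\<close>
  (\<open>exists_zero_row_of_full_row\<close>). For constant rank \<open>r\<close> this excludes full rows and leaves
  \<open>n - 1 - i\<close> positions in each row. In general two full rows \<open>i < k\<close> cannot coexist: in a member
  of \<open>S\<close> whose row \<open>i\<close> is zero, row \<open>k\<close> is zero as well, and adding an element of \<open>W\<close> with leading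
  position \<open>(k, k)\<close> makes row \<open>k\<close> nonzero and keeps row \<open>i\<close> zero, which destroys the echelon form.
  So at most one row contributes an additional position (\<open>dim_ech_affine_space_le\<close>).

  Lower bound. Let the first \<open>s\<close> rows have pivot \<open>1\<close> on the diagonal and arbitrary entries to the
  right of it, let row \<open>s\<close> be an arbitrary vector supported on the columns from \<open>s\<close> on, and let each
  of the rows \<open>s + 1, \<dots>, r - 1\<close> be its predecessor shifted by one column to the right. The
  shift moves the pivot one column to the right, or pushes it out of the matrix, which makes the
  row and all its successors zero; so these matrices are in row echelon form and have ranks between
  \<open>s\<close> and \<open>r\<close>, both of which occur.
\<close>

section \<open>Dimension as a number of leading indices\<close>

text \<open>
  The functionals \<open>\<phi> i\<close> play the role of coordinates. They are indexed by an ordered type so that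
  one result serves matrix entries in row-major order and vector entries from bottom to top.
\<close>

definition leading_indices :: "('i::linorder \<Rightarrow> 'v \<Rightarrow> 'a::zero) \<Rightarrow> 'i set \<Rightarrow> 'v set \<Rightarrow> 'i set" where
  "leading_indices \<phi> I W = {i \<in> I. \<exists>v \<in> W. \<phi> i v \<noteq> 0 \<and> (\<forall>k \<in> I. k < i \<longrightarrow> \<phi> k v = 0)}"

text \<open>
  Induction that removes the least index \<open>b\<close>: the kernel \<open>W'\<close> of \<open>\<phi> b\<close> in \<open>W\<close> is separated by the
  remaining functionals and has the same leading indices, except possibly \<open>b\<close>. If \<open>b\<close> is leading
  for \<open>W\<close>, then \<open>\<phi> b\<close> is nonzero on \<open>W\<close>, its kernel has codimension one, and any \<open>w\<close> with
  \<open>\<phi> b w \<noteq> 0\<close> extends a basis of the kernel.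
\<close>

lemma basis_of_leading_indices:
  fixes V :: "('a::field, 'v, 'd) module_scheme" and \<phi> :: "'i::linorder \<Rightarrow> 'v \<Rightarrow> 'a"
  assumes V: "vectorspace class_ring V"
    and add: "\<And>i v w. i \<in> I \<Longrightarrow> v \<in> carrier V \<Longrightarrow> w \<in> carrier V \<Longrightarrow> \<phi> i (v \<oplus>\<^bsub>V\<^esub> w) = \<phi> i v + \<phi> i w"
    and smult: "\<And>i c v. i \<in> I \<Longrightarrow> v \<in> carrier V \<Longrightarrow> \<phi> i (c \<odot>\<^bsub>V\<^esub> v) = c * \<phi> i v"
    and "finite I" "subspace class_ring W V"
    and "\<And>v. v \<in> W \<Longrightarrow> (\<And>i. i \<in> I \<Longrightarrow> \<phi> i v = 0) \<Longrightarrow> v = \<zero>\<^bsub>V\<^esub>"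
  shows "\<exists>B \<subseteq> W. finite B \<and> \<not> LinearCombinations.module.lin_dep class_ring V B \<and> LinearCombinations.module.span class_ring V B = W \<and>
           card B = card (leading_indices \<phi> I W)"
  using assms(4,2,3,5-)
proof (induction I arbitrary: W rule: finite_linorder_min_induct)
  case empty
  interpret vectorspace class_ring V by (rule V)
  have sub: "submodule class_ring W V" by (rule is_module[OF empty(3)])
  have "W = {\<zero>\<^bsub>V\<^esub>}" using empty(4) submodule.zero_closed[OF sub] by blast
  moreover have "span {} = {\<zero>\<^bsub>V\<^esub>}" by (auto simp: span_def lincomb_def)
  moreover have "\<not> lin_dep {}" by (auto simp: lin_dep_def)
  ultimately show ?case by (intro exI[of _ "{}"]) (auto simp: leading_indices_def)
next
  case (insert b A)
  interpret vectorspace class_ring V by (rule V)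
  have sub: "submodule class_ring W V" by (rule is_module[OF insert.prems(3)])
  interpret W: submodule class_ring W V by (rule sub)
  have WV: "W \<subseteq> carrier V" by (rule W.subset)
  define W' where "W' = {w \<in> W. \<phi> b w = 0}"
  have "\<phi> b \<zero>\<^bsub>V\<^esub> = 0" using insert.prems(2)[of b "\<zero>\<^bsub>V\<^esub>" 0] smult_r_null[of 0] by simp
  then have sub': "subspace class_ring W' V"
    using WV insert.prems(1,2)[of b] unfolding subspace_def submodule_def W'_def
    by (simp add: V module_axioms subset_iff)
  obtain B where B: "B \<subseteq> W'" "finite B" "\<not> lin_dep B" "span B = W'"
    and cardB: "card B = card (leading_indices \<phi> A W')"
  proof -
    have "v = \<zero>\<^bsub>V\<^esub>" if "v \<in> W'" "\<And>i. i \<in> A \<Longrightarrow> \<phi> i v = 0" for v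
      using that by (intro insert.prems(4)) (auto simp: W'_def)
    then show ?thesis
      using insert.IH[OF insert.prems(1,2) sub'] that by blast
  qed
  show ?case
  proof (cases "\<exists>w \<in> W. \<phi> b w \<noteq> 0")
    case False
    then have "W' = W" by (auto simp: W'_def)
    moreover have "leading_indices \<phi> (insert b A) W = leading_indices \<phi> A W"
      using False insert.hyps by (auto simp: leading_indices_def)
    ultimately show ?thesis using B cardB by auto
  next
    case True
    then obtain w where w: "w \<in> W" "\<phi> b w \<noteq> 0" by auto
    have wV: "w \<in> carrier V" using w WV by auto
    have BV: "B \<subseteq> carrier V" using B(1) WV by (auto simp: W'_def)
    have w_notin: "w \<notin> span B" using w by (simp add: B(4) W'_def)
    then have wB: "w \<notin> B" using in_own_span[OF BV] by auto
    have "\<not> lin_dep (insert w B)"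
      using lin_dep_iff_in_span[OF BV B(3) wV wB] w_notin by simp
    moreover have "span (insert w B) = W"
    proof
      show "span (insert w B) \<subseteq> W"
        using B(1) w by (intro span_is_subset sub) (auto simp: W'_def)
      have ins: "insert w B \<subseteq> carrier V" using BV wV by auto
      interpret S: submodule class_ring "span (insert w B)" V
        by (rule span_is_submodule[OF ins])
      show "W \<subseteq> span (insert w B)"
      proof
        fix v assume v: "v \<in> W"
        \<comment> \<open>One elimination step moves \<open>v\<close> into the kernel of \<open>\<phi> b\<close>.\<close>
        define c where "c = \<phi> b v / \<phi> b w"
        define u where "u = v \<oplus>\<^bsub>V\<^esub> (- c) \<odot>\<^bsub>V\<^esub> w"
        have vV: "v \<in> carrier V" using v WV by auto
        have "\<phi> b u = 0"
          using insert.prems(1)[of b v "(- c) \<odot>\<^bsub>V\<^esub> w"] insert.prems(2)[of b w "- c"] vV wV w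
          by (simp add: u_def c_def)
        moreover have "u \<in> W" using v w by (simp add: u_def)
        ultimately have "u \<in> span B" by (simp add: B(4) W'_def)
        then have u: "u \<in> span (insert w B)" using span_is_monotone[of B "insert w B"] by auto
        have "w \<in> span (insert w B)" using in_own_span[OF ins] by auto
        then have "u \<oplus>\<^bsub>V\<^esub> c \<odot>\<^bsub>V\<^esub> w \<in> span (insert w B)" using u by simp
        moreover have "(- c) \<odot>\<^bsub>V\<^esub> w \<oplus>\<^bsub>V\<^esub> c \<odot>\<^bsub>V\<^esub> w = \<zero>\<^bsub>V\<^esub>"
          using smult_l_distr[of "- c" c w] smult_l_null[of w] wV by simp
        then have "u \<oplus>\<^bsub>V\<^esub> c \<odot>\<^bsub>V\<^esub> w = v" using vV wV by (simp add: u_def M.a_assoc)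
        ultimately show "v \<in> span (insert w B)" by simp
      qed
    qed
    moreover have "leading_indices \<phi> (insert b A) W = insert b (leading_indices \<phi> A W')"
    proof -
      have "\<not> k < b" if "k \<in> A" for k using insert.hyps that by (auto dest: order.asym)
      then show ?thesis using insert.hyps w by (auto simp: leading_indices_def W'_def)
    qed
    moreover have "b \<notin> leading_indices \<phi> A W'" using insert.hyps by (auto simp: leading_indices_def)
    moreover have "finite (leading_indices \<phi> A W')" using insert.hyps by (simp add: leading_indices_def)
    ultimately show ?thesis using B w wB cardB
      by (intro exI[of _ "insert w B"]) (auto simp: W'_def)
  qed
qed

lemma dim_eq_card_leading_indices:
  fixes V :: "('a::field, 'v, 'd) module_scheme" and \<phi> :: "'i::linorder \<Rightarrow> 'v \<Rightarrow> 'a"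
  assumes V: "vectorspace class_ring V"
    and add: "\<And>i v w. i \<in> I \<Longrightarrow> v \<in> carrier V \<Longrightarrow> w \<in> carrier V \<Longrightarrow> \<phi> i (v \<oplus>\<^bsub>V\<^esub> w) = \<phi> i v + \<phi> i w"
    and smult: "\<And>i c v. i \<in> I \<Longrightarrow> v \<in> carrier V \<Longrightarrow> \<phi> i (c \<odot>\<^bsub>V\<^esub> v) = c * \<phi> i v"
    and finI: "finite I" and sub: "subspace class_ring W V"
    and sep: "\<And>v. v \<in> W \<Longrightarrow> (\<And>i. i \<in> I \<Longrightarrow> \<phi> i v = 0) \<Longrightarrow> v = \<zero>\<^bsub>V\<^esub>"
  shows "vectorspace.dim class_ring (V\<lparr>carrier := W\<rparr>) = card (leading_indices \<phi> I W)"
proof -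
  interpret vectorspace class_ring V by (rule V)
  obtain B where B: "B \<subseteq> W" "finite B" "\<not> lin_dep B" "span B = W"
      "card B = card (leading_indices \<phi> I W)"
    using basis_of_leading_indices[where \<phi> = \<phi> and I = I and W = W, OF V add smult finI sub sep] by blast
  interpret W: vectorspace class_ring "vs W" by (rule subspace_is_vs[OF sub])
  have "W.basis B"
    using B span_li_not_depend[OF B(1) is_module[OF sub]] by (simp add: W.basis_def)
  then show ?thesis using W.dim_basis[OF B(2)] B(5) by simp
qed


section \<open>Row echelon matrices and their rank\<close>

lemma pivot_col_entry:
  assumes "\<not> zero_row A i"
  shows "pivot_col A i < dim_col A" "A $$ (i, pivot_col A i) \<noteq> 0"
proof -
  have "\<exists>j. j < dim_col A \<and> A $$ (i, j) \<noteq> 0" using assms by (auto simp: zero_row_def)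
  from LeastI_ex[OF this] show "pivot_col A i < dim_col A" "A $$ (i, pivot_col A i) \<noteq> 0"
    by (auto simp: pivot_col_def)
qed

lemma pivot_col_le:
  assumes "j < dim_col A" "A $$ (i, j) \<noteq> 0"
  shows "pivot_col A i \<le> j"
  unfolding pivot_col_def using assms by (intro Least_le) auto

lemma row_echelon_zero_row_below:
  "row_echelon A \<Longrightarrow> zero_row A i \<Longrightarrow> i \<le> k \<Longrightarrow> k < dim_row A \<Longrightarrow> zero_row A k"
  by (cases "i = k") (simp, metis row_echelon_def le_neq_implies_less)

lemma row_echelon_pivot_less:
  assumes "row_echelon A" "i < k" "k < dim_row A" "\<not> zero_row A k"
  shows "pivot_col A i < pivot_col A k"
  using assms(2-)
proof (induction k)
  case (Suc k)
  have "\<not> zero_row A k" using row_echelon_zero_row_below[OF assms(1), of k "Suc k"] Suc.prems by auto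
  moreover from this have "pivot_col A k < pivot_col A (Suc k)"
    using assms(1) Suc.prems by (auto simp: row_echelon_def)
  ultimately show ?case using Suc by (cases "i = k") (auto intro: less_trans)
qed simp

lemma row_echelon_zero_below_pivot:
  assumes "row_echelon A" "i < k" "k < dim_row A" "pivot_col A i < dim_col A"
  shows "A $$ (k, pivot_col A i) = 0"
proof (rule ccontr)
  assume nz: "A $$ (k, pivot_col A i) \<noteq> 0"
  then have "\<not> zero_row A k" using assms by (auto simp: zero_row_def)
  then have "pivot_col A i < pivot_col A k" by (rule row_echelon_pivot_less[OF assms(1-3)])
  moreover have "pivot_col A k \<le> pivot_col A i" by (rule pivot_col_le[OF assms(4) nz])
  ultimately show False by simp
qed

lemma row_echelon_zero_left_of_diagonal:
  assumes "row_echelon A" "i < dim_row A" "j < i" "j < dim_col A"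
  shows "A $$ (i, j) = 0"
proof (rule ccontr)
  assume nz: "A $$ (i, j) \<noteq> 0"
  have "k \<le> pivot_col A k" if "k \<le> i" for k
    using that
  proof (induction k)
    case (Suc k)
    have "\<not> zero_row A (Suc k)"
      using row_echelon_zero_row_below[OF assms(1), of "Suc k" i] nz assms Suc.prems by (auto simp: zero_row_def)
    then have "pivot_col A k < pivot_col A (Suc k)"
      using row_echelon_pivot_less[OF assms(1), of k "Suc k"] Suc.prems assms(2) by simp
    then show ?case using Suc by simp
  qed simp
  then have "i \<le> pivot_col A i" by simp
  also have "\<dots> \<le> j" by (rule pivot_col_le[OF assms(4) nz])
  finally show False using assms(3) by simp
qed

text \<open>
  Read the coordinates of the columns from bottom to top: the column that contains the pivot of
  row \<open>i\<close> has zeros below row \<open>i\<close>, so each nonzero row gives a leading index of the column space;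
  a zero row gives none.
\<close>

lemma rank_row_echelon:
  fixes A :: "'a::field mat"
  assumes A: "A \<in> carrier_mat m n" and ech: "row_echelon A"
  shows "vec_space.rank m A = card {i. i < m \<and> \<not> zero_row A i}"
proof -
  interpret vec_space "TYPE('a)" m .
  define W where "W = span (set (cols A))"
  define \<phi> where "\<phi> = (\<lambda>t (v :: 'a vec). v $ (m - Suc t))"
  have colsV: "set (cols A) \<subseteq> carrier_vec m" using A cols_dim by blast
  have sub: "subspace class_ring W V" unfolding W_def by (rule span_is_subspace) (use colsV in auto)
  have WV: "W \<subseteq> carrier_vec m" unfolding W_def using colsV by (rule span_is_subset2)
  have zero: "v $ i = 0" if "v \<in> W" "i < m" "zero_row A i" for v i
  proof -
    have "set (cols A) \<subseteq> {v \<in> carrier_vec m. v $ i = 0}"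
      using that A by (auto simp: cols_def zero_row_def)
    moreover have "submodule class_ring {v \<in> carrier_vec m. v $ i = 0} V"
      using that(2) by (auto simp: submodule_def module_vec_simps module_axioms)
    ultimately have "W \<subseteq> {v \<in> carrier_vec m. v $ i = 0}" unfolding W_def by (rule span_is_subset)
    then show ?thesis using that by auto
  qed
  have "vectorspace.dim class_ring (V\<lparr>carrier := W\<rparr>) = card (leading_indices \<phi> {..<m} W)"
  proof (rule dim_eq_card_leading_indices)
    show "vectorspace class_ring V" by (rule vec_vs)
    show "v = \<zero>\<^bsub>V\<^esub>" if v: "v \<in> W" and 0: "\<And>t. t \<in> {..<m} \<Longrightarrow> \<phi> t v = 0" for v
    proof -
      have "v $ i = 0" if "i < m" for i using 0[of "m - Suc i"] that by (simp add: \<phi>_def)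
      then show ?thesis using v WV by (intro eq_vecI) (auto simp: module_vec_simps)
    qed
  qed (use sub in \<open>auto simp: \<phi>_def module_vec_simps\<close>)
  also have "leading_indices \<phi> {..<m} W = {t \<in> {..<m}. \<not> zero_row A (m - Suc t)}"
  proof -
    have "t \<in> leading_indices \<phi> {..<m} W" if t: "t < m" and nz: "\<not> zero_row A (m - Suc t)" for t
    proof -
      define p where "p = pivot_col A (m - Suc t)"
      have p: "p < n" "A $$ (m - Suc t, p) \<noteq> 0"
        using pivot_col_entry[OF nz] A by (auto simp: p_def)
      have "col A p \<in> set (cols A)" using p A by (auto simp: cols_def)
      then have "col A p \<in> W" unfolding W_def using in_own_span[OF colsV] by auto
      moreover have "\<phi> t (col A p) \<noteq> 0" using p A t by (auto simp: \<phi>_def)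
      moreover have "\<phi> u (col A p) = 0" if "u < t" for u
        using row_echelon_zero_below_pivot[OF ech, of "m - Suc t" "m - Suc u"] that t p A
        by (auto simp: \<phi>_def p_def)
      ultimately show ?thesis using t by (auto simp: leading_indices_def)
    qed
    then show ?thesis using zero by (auto simp: leading_indices_def \<phi>_def)
  qed
  also have "card \<dots> = card {i. i < m \<and> \<not> zero_row A i}"
    by (rule bij_betw_same_card[of "\<lambda>t. m - Suc t"], rule bij_betwI[of _ _ _ "\<lambda>t. m - Suc t"]) auto
  finally show ?thesis by (simp add: rank_def W_def)
qed

lemma rank_row_echelon_le:
  fixes A :: "'a::field mat"
  assumes "A \<in> carrier_mat m n" "row_echelon A" "zero_row A i" "i < m"
  shows "vec_space.rank m A \<le> i"
proof -
  have "{k. k < m \<and> \<not> zero_row A k} \<subseteq> {..<i}"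
    using row_echelon_zero_row_below[OF assms(2,3)] assms(1) by (force simp: not_le)
  from card_mono[OF _ this] show ?thesis by (simp add: rank_row_echelon[OF assms(1,2)])
qed

lemma row_echelon_zero_row_ge_rank:
  fixes A :: "'a::field mat"
  assumes "A \<in> carrier_mat m n" "row_echelon A" "vec_space.rank m A \<le> i" "i < m"
  shows "zero_row A i"
proof (rule ccontr)
  assume "\<not> zero_row A i"
  then have "{..i} \<subseteq> {k. k < m \<and> \<not> zero_row A k}"
    using row_echelon_zero_row_below[OF assms(2), of _ i] assms(1,4) by auto
  from card_mono[OF _ this] show False
    using assms(3) by (simp add: rank_row_echelon[OF assms(1,2)])
qed

section \<open>Affine subspaces of matrices\<close>

text \<open>
  The order on the index pairs is the lexicographic one, which is the row-major order of positions.
\<close>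

definition lead_pos :: "nat \<Rightarrow> nat \<Rightarrow> 'a::field mat set \<Rightarrow> (nat \<times> nat) set" where
  "lead_pos m n W = leading_indices (\<lambda>p B. B $$ p) ({..<m} \<times> {..<n}) W"

lemma lead_pos_iff:
  "(i, j) \<in> lead_pos m n W \<longleftrightarrow> i < m \<and> j < n \<and>
     (\<exists>B \<in> W. B $$ (i, j) \<noteq> 0 \<and> (\<forall>k < m. \<forall>l < n. k < i \<or> k = i \<and> l < j \<longrightarrow> B $$ (k, l) = 0))"
proof -
  have "(k, l) < (i, j) \<longleftrightarrow> k < i \<or> k = i \<and> l < j" for k l by auto
  then show ?thesis
    unfolding lead_pos_def leading_indices_def by (simp del: less_prod_simp) blast
qed

lemma dim_mat_subspace:
  fixes W :: "'a::field mat set"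
  assumes sub: "subspace class_ring W (module_mat TYPE('a) m n)"
  shows "vectorspace.dim class_ring ((module_mat TYPE('a) m n)\<lparr>carrier := W\<rparr>) = card (lead_pos m n W)"
  unfolding lead_pos_def
proof (rule dim_eq_card_leading_indices[OF vectorspace_module_mat _ _ _ sub])
  have "W \<subseteq> carrier_mat m n"
    using sub by (auto simp: subspace_def submodule_def module_mat_simps)
  then show "B = \<zero>\<^bsub>module_mat TYPE('a) m n\<^esub>"
    if "B \<in> W" "\<And>p. p \<in> {..<m} \<times> {..<n} \<Longrightarrow> B $$ p = 0" for B
    using that by (intro eq_matI) (auto simp: module_mat_simps)
qed (auto simp: module_mat_simps)

lemma mat_affine_subspace_nonempty: "mat_affine_subspace m n S \<Longrightarrow> S \<noteq> {}"
  unfolding mat_affine_subspace_def subspace_def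
  by (auto dest: submodule.zero_closed)

text \<open>
  These facts make the base point and the space of its translations dispensable: the direction is
  the space of translations for every choice of base point.
\<close>

lemma
  fixes S :: "'a::field mat set"
  assumes "mat_affine_subspace m n S"
  shows mat_affine_subspace_carrier: "S \<subseteq> carrier_mat m n"
    and subspace_mat_direction: "subspace class_ring (mat_direction S) (module_mat TYPE('a) m n)"
    and mat_direction_carrier: "mat_direction S \<subseteq> carrier_mat m n"
    and add_mat_direction: "\<And>A B. A \<in> S \<Longrightarrow> B \<in> mat_direction S \<Longrightarrow> A + c \<cdot>\<^sub>m B \<in> S"
proof -
  obtain A0 W where A0: "A0 \<in> carrier_mat m n" and W: "subspace class_ring W (module_mat TYPE('a) m n)"
    and S: "S = {A0 + B | B. B \<in> W}"
    using assms by (auto simp: mat_affine_subspace_def)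
  have sub: "submodule class_ring W (module_mat TYPE('a) m n)" using W by (simp add: subspace_def)
  have WV: "W \<subseteq> carrier_mat m n" using submodule.subset[OF sub] by (simp add: module_mat_simps)
  have add: "B + C \<in> W" if "B \<in> W" "C \<in> W" for B C
    using submodule.m_closed[OF sub that] by (simp add: module_mat_simps)
  have smult: "c \<cdot>\<^sub>m B \<in> W" if "B \<in> W" for B c
    using submodule.smult_closed[OF sub _ that] by (simp add: module_mat_simps)
  have zero: "0\<^sub>m m n \<in> W" using submodule.zero_closed[OF sub] by (simp add: module_mat_simps)
  show carrier: "S \<subseteq> carrier_mat m n" using A0 WV by (auto simp: S)
  have dir: "mat_direction S = W"
  proof
    show "mat_direction S \<subseteq> W"
    proof
      fix D assume "D \<in> mat_direction S"
      then obtain B C where BC: "B \<in> W" "C \<in> W" and D: "D = (A0 + B) - (A0 + C)"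
        by (auto simp: mat_direction_def S)
      have "D = B + (- 1) \<cdot>\<^sub>m C" unfolding D using A0 subsetD[OF WV BC(1)] subsetD[OF WV BC(2)] by (intro eq_matI) auto
      then show "D \<in> W" using add smult BC by simp
    qed
    show "W \<subseteq> mat_direction S"
    proof
      fix B assume B: "B \<in> W"
      have "B = (A0 + B) - (A0 + 0\<^sub>m m n)" using A0 subsetD[OF WV B] by (intro eq_matI) auto
      then show "B \<in> mat_direction S" using B zero by (auto simp: mat_direction_def S)
    qed
  qed
  show "subspace class_ring (mat_direction S) (module_mat TYPE('a) m n)" using W by (simp add: dir)
  show "mat_direction S \<subseteq> carrier_mat m n" using WV by (simp add: dir)
  show "A + c \<cdot>\<^sub>m B \<in> S" if AB: "A \<in> S" "B \<in> mat_direction S" for A B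
  proof -
    obtain C where C: "C \<in> W" "A = A0 + C" using AB by (auto simp: S)
    have "A + c \<cdot>\<^sub>m B = A0 + (C + c \<cdot>\<^sub>m B)"
      using A0 C AB WV unfolding dir by (auto intro!: assoc_add_mat)
    moreover have "C + c \<cdot>\<^sub>m B \<in> W" using add[OF C(1) smult] AB(2) by (simp add: dir)
    then have "A0 + (C + c \<cdot>\<^sub>m B) \<in> S" unfolding S by (intro CollectI exI[of _ "C + c \<cdot>\<^sub>m B"] conjI refl)
    ultimately show ?thesis by simp
  qed
qed


section \<open>The upper bound\<close>

text \<open>
  Clear row \<open>i\<close> from left to right. To the left of the diagonal the echelon form provides the zeros;
  from the diagonal on, an element of the direction with leading position \<open>(i, q)\<close> removes the
  entry in column \<open>q\<close> and does not disturb the entries already cleared.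
\<close>

lemma exists_zero_row_of_full_row:
  fixes S :: "'a::field mat set"
  assumes S: "mat_affine_subspace m n S" and ech: "\<And>A. A \<in> S \<Longrightarrow> row_echelon A" and i: "i < m"
    and full: "\<And>j. i \<le> j \<Longrightarrow> j < n \<Longrightarrow> (i, j) \<in> lead_pos m n (mat_direction S)"
  shows "\<exists>A \<in> S. zero_row A i"
proof -
  have SV: "A \<in> carrier_mat m n" if "A \<in> S" for A using mat_affine_subspace_carrier[OF S] that by auto
  have DV: "B \<in> carrier_mat m n" if "B \<in> mat_direction S" for B
    using mat_direction_carrier[OF S] that by auto
  have "q \<le> n \<Longrightarrow> \<exists>A \<in> S. \<forall>j < q. A $$ (i, j) = 0" for q
  proof (induction q)
    case 0
    then show ?case using mat_affine_subspace_nonempty[OF S] by auto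
  next
    case (Suc q)
    then obtain A where A: "A \<in> S" "\<forall>j < q. A $$ (i, j) = 0" by auto
    show ?case
    proof (cases "i \<le> q")
      case False
      then have "A $$ (i, q) = 0"
        using row_echelon_zero_left_of_diagonal[OF ech[OF A(1)], of i q] SV[OF A(1)] i Suc.prems by auto
      then show ?thesis using A by (auto simp: less_Suc_eq)
    next
      case True
      then obtain B where B: "B \<in> mat_direction S" "B $$ (i, q) \<noteq> 0" "\<forall>j < q. B $$ (i, j) = 0"
        using full[of q] Suc.prems i unfolding lead_pos_iff by auto
      define A' where "A' = A + (- A $$ (i, q) / B $$ (i, q)) \<cdot>\<^sub>m B"
      have "A' \<in> S" unfolding A'_def by (rule add_mat_direction[OF S A(1) B(1)])
      moreover have "A' $$ (i, j) = 0" if "j < Suc q" for j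
        using that A B SV[OF A(1)] DV[OF B(1)] i Suc.prems by (auto simp: A'_def less_Suc_eq)
      ultimately show ?thesis by blast
    qed
  qed
  from this[of n] show ?thesis using SV by (auto simp: zero_row_def)
qed

lemma ech_affine_spaces_rank:
  fixes S :: "'a::field mat set"
  assumes S: "S \<in> ech_affine_spaces m n s r" and A: "A \<in> S"
  shows "s \<le> vec_space.rank m A" "vec_space.rank m A \<le> r"
proof -
  let ?R = "{vec_space.rank m A | A. A \<in> S}"
  have *: "mat_affine_subspace m n S" "\<And>A. A \<in> S \<Longrightarrow> row_echelon A" "s = Min ?R" "r = Max ?R"
    using S by (auto simp: ech_affine_spaces_def)
  have "vec_space.rank m A \<le> n" if "A \<in> S" for A
    using mat_affine_subspace_carrier[OF *(1)] that by (intro vec_space.rank_le_nc) auto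
  then have "?R \<subseteq> {..n}" by auto
  then have "finite ?R" by (rule finite_subset) simp
  then show "s \<le> vec_space.rank m A" "vec_space.rank m A \<le> r"
    using A unfolding *(3,4) by (auto intro: Min_le Max_ge)
qed

text \<open>
  Here \<open>F\<close> is the set of full rows. Choosing one missing position in each of the other \<open>r - card F\<close>
  rows gives as many elements of the staircase outside \<open>L\<close>.
\<close>

lemma card_add_missed_rows_le:
  fixes L :: "(nat \<times> nat) set"
  assumes L: "L \<subseteq> Sigma {..<r} (\<lambda>i. {i..<n})" and "r \<le> n"
    and F: "F = {i. i < r \<and> (\<forall>j. i \<le> j \<and> j < n \<longrightarrow> (i, j) \<in> L)}"
  shows "card L \<le> (\<Sum>i<r. n - 1 - i) + card F"
proof -
  define N where "N = {..<r} - F"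
  obtain g where g: "\<And>i. i \<in> N \<Longrightarrow> i \<le> g i \<and> g i < n \<and> (i, g i) \<notin> L"
    unfolding N_def F by atomize_elim (intro choice, auto)
  let ?M = "(\<lambda>i. (i, g i)) ` N"
  have finL: "finite L" by (rule finite_subset[OF L]) auto
  have "card L + card N = card (L \<union> ?M)"
    using g finL by (subst card_Un_disjoint) (auto simp: N_def card_image inj_on_def)
  also have "\<dots> \<le> card (Sigma {..<r} (\<lambda>i. {i..<n}))"
    using L g by (intro card_mono) (auto simp: N_def)
  also have "\<dots> = (\<Sum>i<r. n - i)" by (simp add: card_SigmaI)
  also have "\<dots> = (\<Sum>i<r. (n - 1 - i) + 1)" using \<open>r \<le> n\<close> by (intro sum.cong) simp_all
  also have "\<dots> = (\<Sum>i<r. n - 1 - i) + r" by (subst sum.distrib) simp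
  finally have "card L + card N \<le> (\<Sum>i<r. n - 1 - i) + r" .
  moreover have "r = card N + card F"
  proof -
    have "F \<subseteq> {..<r}" by (auto simp: F)
    from card_mono[OF _ this] card_Diff_subset[OF finite_subset[OF this] this]
    show ?thesis by (simp add: N_def)
  qed
  ultimately show ?thesis by simp
qed

lemma dim_ech_affine_space_le:
  fixes S :: "'a::field mat set"
  assumes S: "S \<in> ech_affine_spaces m n s r" and r: "r \<le> min m n"
  shows "mat_affine_dim m n S \<le> (\<Sum>i<r. n - 1 - i) + (if s = r then 0 else 1)"
proof -
  have aff: "mat_affine_subspace m n S" and ech: "\<And>A. A \<in> S \<Longrightarrow> row_echelon A"
    using S by (auto simp: ech_affine_spaces_def)
  have SV: "A \<in> carrier_mat m n" if "A \<in> S" for A using mat_affine_subspace_carrier[OF aff] that by auto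
  define L where "L = lead_pos m n (mat_direction S)"
  define F where "F = {i. i < r \<and> (\<forall>j. i \<le> j \<and> j < n \<longrightarrow> (i, j) \<in> L)}"
  have zero: "A $$ (i, j) = 0" if "A \<in> S" "i < m" "j < n" "j < i \<or> r \<le> i" for A i j
    using that(4)
  proof
    assume "j < i"
    then show ?thesis using row_echelon_zero_left_of_diagonal[OF ech[OF that(1)], of i j] that SV[OF that(1)] by auto
  next
    assume "r \<le> i"
    then have "zero_row A i"
      using ech_affine_spaces_rank(2)[OF S that(1)] that
      by (intro row_echelon_zero_row_ge_rank[OF SV ech]) auto
    then show ?thesis using that SV[OF that(1)] by (auto simp: zero_row_def)
  qed
  have "L \<subseteq> Sigma {..<r} (\<lambda>i. {i..<n})"
  proof clarify
    fix i j assume "(i, j) \<in> L"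
    then obtain B where B: "i < m" "j < n" "B \<in> mat_direction S" "B $$ (i, j) \<noteq> 0"
      by (auto simp: L_def lead_pos_iff)
    then obtain A C where "A \<in> S" "C \<in> S" "B = A - C" by (auto simp: mat_direction_def)
    then have "\<not> (j < i \<or> r \<le> i)" using B zero[of A i j] zero[of C i j] SV[of A] SV[of C] by auto
    then show "i \<in> {..<r} \<and> j \<in> {i..<n}" using B by auto
  qed
  then have cardL: "card L \<le> (\<Sum>i<r. n - 1 - i) + card F"
    using r by (intro card_add_missed_rows_le F_def) simp_all
  have kill: "\<exists>A \<in> S. zero_row A i" if "i \<in> F" for i
    using that r unfolding F_def L_def by (intro exists_zero_row_of_full_row[OF aff ech]) auto
  have "card F \<le> (if s = r then 0 else 1)"
  proof (cases "s = r")
    case True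
    have "F = {}"
    proof (rule equals0I)
      fix i assume i: "i \<in> F"
      then obtain A where A: "A \<in> S" "zero_row A i" using kill by auto
      then have "vec_space.rank m A \<le> i"
        using i r by (intro rank_row_echelon_le[OF SV ech]) (auto simp: F_def)
      then show False using ech_affine_spaces_rank(1)[OF S A(1)] i True by (auto simp: F_def)
    qed
    then show ?thesis by simp
  next
    case False
    have no: "\<not> i < k" if ik: "i \<in> F" "k \<in> F" for i k
    proof
      assume "i < k"
      obtain A where A: "A \<in> S" "zero_row A i" using kill ik by auto
      have k: "k < m" "k < n" "i < m" using ik r by (auto simp: F_def)
      have Ak: "zero_row A k"
        using row_echelon_zero_row_below[OF ech[OF A(1)] A(2), of k] \<open>i < k\<close> k SV[OF A(1)] by auto
      \<comment> \<open>Row \<open>k\<close> is full, so \<open>(k, k)\<close> is leading; adding \<open>B\<close> to \<open>A\<close> revives row \<open>k\<close> below a zero row.\<close>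
      obtain B where B: "B \<in> mat_direction S" "B $$ (k, k) \<noteq> 0"
          "\<forall>k' < m. \<forall>l < n. k' < k \<or> k' = k \<and> l < k \<longrightarrow> B $$ (k', l) = 0"
        using ik k unfolding F_def L_def lead_pos_iff by blast
      have BV: "B \<in> carrier_mat m n" using mat_direction_carrier[OF aff] B(1) by auto
      have A': "A + 1 \<cdot>\<^sub>m B \<in> S" by (rule add_mat_direction[OF aff A(1) B(1)])
      have Bi: "B $$ (i, j) = 0" if "j < n" for j using B(3) \<open>i < k\<close> k that by blast
      have "zero_row (A + 1 \<cdot>\<^sub>m B) i"
        using A(2) Bi BV SV[OF A(1)] k by (simp add: zero_row_def)
      moreover have "\<not> zero_row (A + 1 \<cdot>\<^sub>m B) k"
      proof -
        have "(A + 1 \<cdot>\<^sub>m B) $$ (k, k) \<noteq> 0" using Ak B(2) BV SV[OF A(1)] k by (simp add: zero_row_def)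
        then show ?thesis using k BV by (auto simp: zero_row_def)
      qed
      ultimately show False
        using row_echelon_zero_row_below[OF ech[OF A'], of i k] \<open>i < k\<close> k BV by auto
    qed
    have "finite F" by (simp add: F_def)
    moreover have "\<forall>x \<in> F. \<forall>y \<in> F. x = y" using no by (meson nat_neq_iff)
    ultimately have "card F \<le> 1" by (simp add: card_le_Suc0_iff_eq)
    then show ?thesis using False by simp
  qed
  then show ?thesis
    using cardL unfolding mat_affine_dim_def dim_mat_subspace[OF subspace_mat_direction[OF aff]] L_def
    by simp
qed


section \<open>The shift construction\<close>

text \<open>
  The direction of the construction, described by equations so that it is evidently a subspace.
  Rows \<open>s, \<dots>, r - 1\<close> form a Toeplitz block, whose entries depend on \<open>j - i\<close> only; with the
  condition \<open>s < i\<close> the last equations express each later row of the block through row \<open>s\<close>.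
\<close>

definition shift_space :: "nat \<Rightarrow> nat \<Rightarrow> nat \<Rightarrow> nat \<Rightarrow> 'a::field mat set" where
  "shift_space m n s r = {B \<in> carrier_mat m n. \<forall>i < m. \<forall>j < n.
     (j < i \<or> r \<le> i \<or> j = i \<and> i < s \<longrightarrow> B $$ (i, j) = 0) \<and>
     (s < i \<and> i < r \<and> i \<le> j \<longrightarrow> B $$ (i, j) = B $$ (s, s + (j - i)))}"

definition shift_affine :: "nat \<Rightarrow> nat \<Rightarrow> nat \<Rightarrow> nat \<Rightarrow> 'a::field mat set" where
  "shift_affine m n s r =
     {mat m n (\<lambda>(i, j). if i = j \<and> i < s then 1 else 0) + B | B. B \<in> shift_space m n s r}"

lemma subspace_shift_space:
  "subspace class_ring (shift_space m n s r) (module_mat TYPE('a::field) m n)" if "r \<le> m"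
proof -
  interpret vectorspace class_ring "module_mat TYPE('a) m n" by (rule vectorspace_module_mat)
  show ?thesis
    using that unfolding subspace_def submodule_def shift_space_def
    by (auto simp: vectorspace_module_mat module_axioms module_mat_simps)
qed

lemma mat_affine_subspace_shift_affine: "r \<le> m \<Longrightarrow> mat_affine_subspace m n (shift_affine m n s r)"
  unfolding mat_affine_subspace_def shift_affine_def
  by (intro bexI[of _ "mat m n (\<lambda>(i, j). if i = j \<and> i < s then 1 else 0)"]
      exI[of _ "shift_space m n s r"]) (auto intro: subspace_shift_space)

lemma shift_affine_iff:
  assumes "s \<le> r" "r \<le> m"
  shows "A \<in> shift_affine m n s r \<longleftrightarrow> A \<in> carrier_mat m n \<and> (\<forall>i < m. \<forall>j < n.
     (j < i \<or> r \<le> i \<longrightarrow> A $$ (i, j) = 0) \<and> (j = i \<and> i < s \<longrightarrow> A $$ (i, j) = 1) \<and>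
     (s < i \<and> i < r \<and> i \<le> j \<longrightarrow> A $$ (i, j) = A $$ (s, s + (j - i))))"
    (is "_ \<longleftrightarrow> ?P A")
proof
  let ?E = "mat m n (\<lambda>(i, j). if i = j \<and> i < s then 1 else 0)"
  show "?P A" if "A \<in> shift_affine m n s r"
    using that assms by (auto simp: shift_affine_def shift_space_def)
  assume P: "?P A"
  then have "A - ?E \<in> shift_space m n s r" using assms by (auto simp: shift_space_def)
  moreover have "A = ?E + (A - ?E)" using P by (intro eq_matI) auto
  ultimately show "A \<in> shift_affine m n s r" by (auto simp: shift_affine_def)
qed

lemma shift_affine_row_echelon:
  assumes sr: "s \<le> r" "r \<le> m" and rn: "r \<le> n" and A: "A \<in> shift_affine m n s r"
  shows "row_echelon A"
proof -
  note A = A[unfolded shift_affine_iff[OF sr]]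
  have dim: "dim_row A = m" "dim_col A = n" using A by auto
  have zero: "A $$ (i, j) = 0" if "i < m" "j < n" "j < i \<or> r \<le> i" for i j using A that by auto
  have one: "A $$ (i, i) = 1" if "i < s" for i
  proof -
    have "i < m" "i < n" using that sr rn by simp_all
    then show ?thesis using A that by simp
  qed
  have first: "A $$ (i, j) = A $$ (s, s + (j - i))" if "s \<le> i" "i < r" "i \<le> j" "j < n" for i j
    using A that sr by (cases "s = i") simp_all
  have shift: "A $$ (k, j) = A $$ (i, j - (k - i))" if "s \<le> i" "i \<le> k" "k < r" "k \<le> j" "j < n" for i k j
    using first[of k j] first[of i "j - (k - i)"] that by simp
  show ?thesis
    unfolding row_echelon_def dim
  proof (intro conjI allI impI)
    fix i k assume ik: "i < k" "k < m" "zero_row A i"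
    have "s \<le> i"
    proof (rule ccontr)
      assume "\<not> s \<le> i"
      then have "A $$ (i, i) = 1" "i < n" using one sr rn by auto
      then show False using ik(3) by (simp add: zero_row_def dim)
    qed
    show "zero_row A k"
      unfolding zero_row_def dim
    proof (intro allI impI)
      fix j assume j: "j < n"
      show "A $$ (k, j) = 0"
      proof (cases "r \<le> k \<or> j < k")
        case True
        then show ?thesis using zero ik(2) j by auto
      next
        case False
        then show ?thesis using shift[of i k j] \<open>s \<le> i\<close> ik j by (simp add: zero_row_def dim)
      qed
    qed
  next
    fix i assume i: "Suc i < m" "\<not> zero_row A i" "\<not> zero_row A (Suc i)"
    define q where "q = pivot_col A (Suc i)"
    have q: "q < n" "A $$ (Suc i, q) \<noteq> 0" using pivot_col_entry[OF i(3)] by (auto simp: q_def dim)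
    have qi: "Suc i \<le> q" "Suc i < r"
      using zero[OF i(1) q(1)] q(2) by linarith+
    show "pivot_col A i < pivot_col A (Suc i)"
    proof (cases "i < s")
      case True
      then have "pivot_col A i \<le> i" using one[of i] qi(1) q(1) by (intro pivot_col_le) (simp_all add: dim)
      then show ?thesis using qi by (simp add: q_def)
    next
      case False
      then have "pivot_col A i \<le> q - 1"
        using shift[of i "Suc i" q] q qi by (intro pivot_col_le) (simp_all add: dim)
      then show ?thesis using qi by (simp add: q_def)
    qed
  qed
qed

text \<open>
  The matrices \<open>E t\<close> with \<open>t\<close> ones on the diagonal show that the ranks \<open>s\<close> and \<open>r\<close> are attained: \<open>E r\<close>
  belongs to the space because its rows \<open>s, \<dots>, r - 1\<close> are the shifts of a unit vector.
\<close>

lemma shift_affine_in_ech_affine_spaces: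
  assumes sr: "s \<le> r" "r \<le> m" and rn: "r \<le> n"
  shows "shift_affine m n s r \<in> ech_affine_spaces m n s r"
proof -
  let ?S = "shift_affine m n s r :: 'a::field mat set"
  have ech: "row_echelon A" if "A \<in> ?S" for A using shift_affine_row_echelon[OF sr rn that] .
  have rank: "vec_space.rank m A = card {i. i < m \<and> \<not> zero_row A i}" if "A \<in> ?S" for A
    using that ech by (intro rank_row_echelon) (auto simp: shift_affine_iff[OF sr])
  have ge: "s \<le> vec_space.rank m A" if "A \<in> ?S" for A
  proof -
    have "\<not> zero_row A i" if "i < s" for i
    proof -
      have "i < m" "i < n" using that sr rn by simp_all
      moreover from this have "A $$ (i, i) = 1"
        using \<open>A \<in> ?S\<close> that unfolding shift_affine_iff[OF sr] by simp
      moreover have "dim_col A = n" using \<open>A \<in> ?S\<close> unfolding shift_affine_iff[OF sr] by auto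
      ultimately show ?thesis by (auto simp: zero_row_def)
    qed
    then have "{..<s} \<subseteq> {i. i < m \<and> \<not> zero_row A i}" using sr by auto
    from card_mono[OF _ this] show ?thesis by (simp add: rank[OF that])
  qed
  have le: "vec_space.rank m A \<le> r" if "A \<in> ?S" for A
  proof -
    have "zero_row A i" if "i < m" "r \<le> i" for i
      using \<open>A \<in> ?S\<close> that unfolding shift_affine_iff[OF sr] by (auto simp: zero_row_def)
    then have "{i. i < m \<and> \<not> zero_row A i} \<subseteq> {..<r}" by (auto intro: ccontr)
    from card_mono[OF _ this] show ?thesis by (simp add: rank[OF that])
  qed
  define E where "E t = mat m n (\<lambda>(i, j). if i = j \<and> i < t then 1 else 0 :: 'a)" for t
  have E: "E t \<in> ?S" "vec_space.rank m (E t) = t" if t: "t = s \<or> t = r" for t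
  proof -
    show S: "E t \<in> ?S" using t sr rn by (auto simp: shift_affine_iff[OF sr] E_def)
    have "{i. i < m \<and> \<not> zero_row (E t) i} = {..<t}"
    proof (intro equalityI subsetI)
      fix i assume "i \<in> {i. i < m \<and> \<not> zero_row (E t) i}"
      then show "i \<in> {..<t}" by (auto simp: zero_row_def E_def split: if_splits)
    next
      fix i assume "i \<in> {..<t}"
      then have "i < m" "i < n" "i < t" using t sr rn by auto
      then show "i \<in> {i. i < m \<and> \<not> zero_row (E t) i}"
        by (auto simp: zero_row_def E_def intro!: exI[of _ i])
    qed
    then show "vec_space.rank m (E t) = t" by (simp add: rank[OF S])
  qed
  let ?R = "{vec_space.rank m A | A. A \<in> ?S}"
  have "?R \<subseteq> {..r}" using le by auto
  then have fin: "finite ?R" by (rule finite_subset) simp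
  have "t \<in> ?R" if "t = s \<or> t = r" for t
    by (intro CollectI exI[of _ "E t"]) (simp add: E[OF that])
  then have "s \<in> ?R" "r \<in> ?R" by simp_all
  then have "s = Min ?R" "r = Max ?R"
    using ge le fin by (intro Min_eqI[symmetric] Max_eqI[symmetric]; auto)+
  then show ?thesis
    using mat_affine_subspace_shift_affine[OF sr(2)] ech unfolding ech_affine_spaces_def by blast
qed

text \<open>
  The leading positions are exhibited by matrix units in the first \<open>s\<close> rows and by the Toeplitz
  matrices of unit vectors for row \<open>s\<close>.
\<close>

lemma dim_shift_affine_ge:
  assumes sr: "s \<le> r" "r \<le> m" and rn: "r \<le> n"
  shows "(\<Sum>i<s. n - 1 - i) + (if s < r then n - s else 0)
    \<le> mat_affine_dim m n (shift_affine m n s r :: 'a::field mat set)"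
proof -
  let ?S = "shift_affine m n s r :: 'a mat set"
  let ?P = "Sigma {..<s} (\<lambda>i. {Suc i..<n})" and ?Q = "if s < r then {s} \<times> {s..<n} else {}"
  note aff = mat_affine_subspace_shift_affine[OF sr(2), of n s, where 'a = 'a]
  define E :: "'a mat" where "E = mat m n (\<lambda>(i, j). if i = j \<and> i < s then 1 else 0)"
  have E: "E \<in> ?S" using sr rn by (auto simp: shift_affine_iff[OF sr] E_def)
  have dir: "B \<in> mat_direction ?S" if "E + B \<in> ?S" "B \<in> carrier_mat m n" for B
  proof -
    have "B = (E + B) - E" using that(2) by (intro eq_matI) (auto simp: E_def)
    then show ?thesis using that(1) E by (auto simp: mat_direction_def)
  qed
  have "(i, j) \<in> lead_pos m n (mat_direction ?S)" if ij: "i < s" "i < j" "j < n" for i j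
  proof -
    define B :: "'a mat" where "B = mat m n (\<lambda>p. if p = (i, j) then 1 else 0)"
    have "E + B \<in> ?S" using sr rn ij by (auto simp: shift_affine_iff[OF sr] E_def B_def)
    then have "B \<in> mat_direction ?S" by (rule dir) (simp add: B_def)
    then show ?thesis
      using ij sr unfolding lead_pos_iff by (auto intro!: bexI[of _ B] simp: B_def)
  qed
  then have "?P \<subseteq> lead_pos m n (mat_direction ?S)" by auto
  moreover have "?Q \<subseteq> lead_pos m n (mat_direction ?S)"
  proof (cases "s < r")
    case True
    have "(s, j) \<in> lead_pos m n (mat_direction ?S)" if j: "s \<le> j" "j < n" for j
    proof -
      define B :: "'a mat" where
        "B = mat m n (\<lambda>(k, l). if s \<le> k \<and> k < r \<and> l + s = j + k then 1 else 0)"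
      have "E + B \<in> ?S" using sr rn j True by (auto simp: shift_affine_iff[OF sr] E_def B_def)
      then have "B \<in> mat_direction ?S" by (rule dir) (simp add: B_def)
      then show ?thesis
        using j sr True unfolding lead_pos_iff by (auto intro!: bexI[of _ B] simp: B_def)
    qed
    then show ?thesis using True by auto
  qed simp
  ultimately have "card (?P \<union> ?Q) \<le> card (lead_pos m n (mat_direction ?S))"
    by (intro card_mono) (auto simp: lead_pos_def leading_indices_def)
  moreover have "card (?P \<union> ?Q) = card ?P + card ?Q" by (intro card_Un_disjoint) auto
  moreover have "card ?P = (\<Sum>i<s. n - 1 - i)" by (simp add: card_SigmaI)
  ultimately show ?thesis
    unfolding mat_affine_dim_def dim_mat_subspace[OF subspace_mat_direction[OF aff]]
    by (auto split: if_splits)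
qed

section \<open>The bounds\<close>

lemma real_sum_staircase:
  "r \<le> n \<Longrightarrow> real (\<Sum>i<r. n - 1 - i) = real r * real n - real r * (real r + 1) / 2"
proof (induction r)
  case (Suc r)
  then have "real (n - 1 - r) = real n - 1 - real r" by simp
  then show ?case using Suc by (simp add: field_simps)
qed simp

theorem theorem13:
  fixes m n s r :: nat
  assumes "s \<le> r" and "r \<le> min m n"
    and "infinite (UNIV :: 'a::field set) \<or> r + 1 \<le> card (UNIV :: 'a set)"
  shows "(s = r \<longrightarrow>
            real (a_ech TYPE('a) m n s r) = real r * real n - real r * (real r + 1) / 2) \<and>
         (s < r \<longrightarrow>
            real s * real n - real s * (real s + 1) / 2 + real n - real s
              \<le> real (a_ech TYPE('a) m n s r) \<and>
            real (a_ech TYPE('a) m n s r)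
              \<le> real r * real n - real r * (real r + 1) / 2 + 1)"
proof -
  let ?D = "{mat_affine_dim m n S | S :: 'a mat set. S \<in> ech_affine_spaces m n s r}"
  let ?u = "(\<Sum>i<r. n - 1 - i) + (if s = r then 0 else 1)"
  let ?S = "shift_affine m n s r :: 'a mat set"
  have le: "d \<le> ?u" if "d \<in> ?D" for d
    using that dim_ech_affine_space_le[OF _ assms(2), where 'a = 'a] by blast
  then have "?D \<subseteq> {..?u}" by blast
  then have fin: "finite ?D" by (rule finite_subset) simp
  have mem: "mat_affine_dim m n ?S \<in> ?D"
    using shift_affine_in_ech_affine_spaces[of s r m n] assms(1,2) by auto
  have "a_ech TYPE('a) m n s r \<le> ?u"
    unfolding a_ech_def using fin le mem by (intro Max.boundedI) auto
  moreover have "mat_affine_dim m n ?S \<le> a_ech TYPE('a) m n s r"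
    unfolding a_ech_def by (intro Max_ge fin mem)
  moreover have "(\<Sum>i<s. n - 1 - i) + (if s < r then n - s else 0) \<le> mat_affine_dim m n ?S"
    using dim_shift_affine_ge[of s r m n] assms(1,2) by simp
  moreover have "real (\<Sum>i<s. n - 1 - i) = real s * real n - real s * (real s + 1) / 2"
    "real (\<Sum>i<r. n - 1 - i) = real r * real n - real r * (real r + 1) / 2"
    using real_sum_staircase[of s n] real_sum_staircase[of r n] assms(1,2) by simp_all
  ultimately show ?thesis using assms(1,2) by (auto simp del: of_nat_sum split: if_splits)
qed

end
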